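(* Let $(C,e,\lambda,\oplus)$ be the free Catalan structure with secondary operations $\gamma,\ominus$, and let $M=h\circ\mathrm{rev}\colon C\to C$, with $h$, $\mathrm{rev}$, $\gamma$, $\ominus$ as defined in the context. Then for all $t,u,v\in C$, $$M(e)=e,\qquad M(\lambda(t))=\gamma(M(t)),\qquad M(u\oplus v)=M(u)\ominus M(v).$$
   Context: A Catalan structure is a quadruple $(C,e,\lambda,\oplus)$ where $C=\bigsqcup_{n\ge 0}C_n$ with $C_0=\{e\}$ ($|t|=n$ for $t\in C_n$), $\lambda\colon C_n\to C_{n+1}$, $\oplus\colon C_m\times C_n\to C_{m+n}$, $\oplus$ is associative with two-sided identity $e$, and every $t\in C$ can be written uniquely in exactly one of three forms: $t=e$; $t=\lambda(s)$ with $s\in C$ (indecomposable); $t=u\oplus v$ with $u$ indecomposable and $v\in C\setminus C_0$ (decomposable). Hence every nonempty $t$ is uniquely $\lambda(u)\oplus v$ ($v=e$ allowed). The free Catalan structure is realized by the formal expressions $e$, $\lambda(t)$, $\lambda(u)\oplus v$ with $v\ne e$; it is isomorphic to rooted plane trees written as lists of children, with $e=[\,]$, $\lambda(T)=[T]$, $\oplus$ = concatenation of child lists. Secondary operations: $\gamma(t)=t\oplus\lambda(e)$, and $\ominus$ is defined by $e\ominus v=v$, $\lambda(u)\ominus v=\lambda(u\ominus v)$, $(t\oplus u)\ominus v=t\oplus(u\ominus v)$ for $t,u\ne e$ (well defined; one may take $t$ indecomposable). The maps: $h(e)=e$, $h(\lambda(u)\oplus v)=h(v)\ominus\gamma(h(u))$;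 $\mathrm{rev}(e)=e$, $\mathrm{rev}(\lambda(u)\oplus v)=\mathrm{rev}(v)\oplus\lambda(\mathrm{rev}(u))$. *)

theory Defs
  imports Main
begin

locale catalan_structure =
  fixes C :: "nat \<Rightarrow> 'a set"
    and e :: 'a
    and lam :: "'a \<Rightarrow> 'a"
    and oplus :: "'a \<Rightarrow> 'a \<Rightarrow> 'a"
  assumes disjoint_grades: "m \<noteq> n \<Longrightarrow> C m \<inter> C n = {}"
    and grade_0: "C 0 = {e}"
    and lam_grade: "t \<in> C n \<Longrightarrow> lam t \<in> C (Suc n)"
    and oplus_grade: "t \<in> C m \<Longrightarrow> u \<in> C n \<Longrightarrow> oplus t u \<in> C (m + n)"
    and oplus_assoc: "\<lbrakk>t \<in> (\<Union>n. C n); u \<in> (\<Union>n. C n); v \<in> (\<Union>n. C n)\<rbrakk>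
          \<Longrightarrow> oplus (oplus t u) v = oplus t (oplus u v)"
    and oplus_left_id: "t \<in> (\<Union>n. C n) \<Longrightarrow> oplus e t = t"
    and oplus_right_id: "t \<in> (\<Union>n. C n) \<Longrightarrow> oplus t e = t"
    and forms: "t \<in> (\<Union>n. C n) \<Longrightarrow>
          t = e \<or> (\<exists>s \<in> (\<Union>n. C n). t = lam s) \<or>
          (\<exists>u \<in> (\<Union>n. C n). \<exists>v \<in> (\<Union>n. C n) - C 0. t = oplus (lam u) v)"
    \<comment> \<open>\<^term>\<open>e\<close> is separated from the other two forms by the grading\<close>
    and indecomposable_not_decomposable:
          "\<lbrakk>s \<in> (\<Union>n. C n); u \<in> (\<Union>n. C n); v \<in> (\<Union>n. C n) - C 0\<rbrakk>
          \<Longrightarrow> lam s \<noteq> oplus (lam u) v"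
    and indecomposable_unique: "inj_on lam (\<Union>n. C n)"
    and decomposable_unique:
          "\<lbrakk>u \<in> (\<Union>n. C n); v \<in> (\<Union>n. C n) - C 0; u' \<in> (\<Union>n. C n); v' \<in> (\<Union>n. C n) - C 0;
            oplus (lam u) v = oplus (lam u') v'\<rbrakk> \<Longrightarrow> lam u = lam u' \<and> v = v'"

text \<open>
  The free Catalan structure, realized by rooted plane trees: a tree is the list of the
  subtrees at the children of its root, and its size is its number of edges.
\<close>

datatype ptree = Node (children: "ptree list")

definition emp :: ptree where
  "emp = Node []"

definition lam :: "ptree \<Rightarrow> ptree" where
  "lam t = Node [t]"

definition oplus :: "ptree \<Rightarrow> ptree \<Rightarrow> ptree"  (infixr "\<oplus>" 65) where
  "t \<oplus> u = Node (children t @ children u)"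

fun edges :: "ptree \<Rightarrow> nat" where
  "edges (Node []) = 0"
| "edges (Node (u # vs)) = Suc (edges u + edges (Node vs))"

lemma edges_oplus [simp]: "edges (t \<oplus> u) = edges t + edges u"
proof -
  have "edges (Node (ts @ us)) = edges (Node ts) + edges (Node us)" for ts us
    by (induction ts) auto
  then show ?thesis
    by (cases t; cases u) (simp add: oplus_def)
qed

lemma edges_eq_0_iff [simp]: "edges t = 0 \<longleftrightarrow> t = emp"
  by (cases t rule: edges.cases) (auto simp: emp_def)

interpretation ptree: catalan_structure "\<lambda>n. {t. edges t = n}" emp lam "(\<oplus>)"
proof (unfold_locales, goal_cases)
  case (8 t)
  show ?case
  proof (cases t rule: edges.cases)
    case 1
    then show ?thesis by (simp add: emp_def)
  next
    case (2 u vs)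
    then show ?thesis
      by (cases vs) (auto simp: lam_def oplus_def emp_def intro!: bexI[of _ "Node vs"])
  qed
next
  case (9 s u v)
  then show ?case by (cases v) (auto simp: lam_def oplus_def emp_def)
next
  case (11 u v u' v')
  then show ?case by (cases v; cases v') (auto simp: lam_def oplus_def)
next
  case (4 t m u n)
  then show ?case by simp
qed (auto simp: lam_def oplus_def emp_def inj_on_def)

lemma ptree_induct [case_names emp cons]:
  assumes "P emp" and "\<And>u v. P u \<Longrightarrow> P v \<Longrightarrow> P (lam u \<oplus> v)"
  shows "P t"
proof (induction t rule: edges.induct)
  case 1
  then show ?case using assms(1) by (simp add: emp_def)
next
  case (2 u vs)
  then show ?case using assms(2)[of u "Node vs"] by (simp add: lam_def oplus_def)
qed

text \<open>Freeness: there is exactly one homomorphism into any Catalan structure.\<close>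

lemma ptree_initial:
  assumes "catalan_structure C e' lam' oplus'"
  shows "\<exists>!f. (\<forall>t. f t \<in> C (edges t)) \<and> f emp = e' \<and> (\<forall>t. f (lam t) = lam' (f t)) \<and>
              (\<forall>t u. f (t \<oplus> u) = oplus' (f t) (f u))"
proof -
  interpret C: catalan_structure C e' lam' oplus' by fact
  define f where "f = rec_ptree (\<lambda>ps. foldr (\<lambda>p. oplus' (lam' (snd p))) ps e')"
  have f0: "f emp = e'"
    by (simp add: f_def emp_def)
  have f1: "f (lam u \<oplus> v) = oplus' (lam' (f u)) (f v)" for u v
    by (cases v) (simp add: f_def lam_def oplus_def)
  have fC: "f t \<in> C (edges t)" for t
  proof (induction t rule: ptree_induct)
    case emp
    then show ?case using C.grade_0 f0 by (metis edges_eq_0_iff singletonI)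
  next
    case (cons u v)
    then have "oplus' (lam' (f u)) (f v) \<in> C (Suc (edges u) + edges v)"
      by (intro C.oplus_grade C.lam_grade)
    moreover have "edges (lam u) = Suc (edges u)"
      by (simp add: lam_def emp_def)
    ultimately show ?case by (simp add: f1)
  qed
  then have fU: "f t \<in> (\<Union>n. C n)" for t
    by blast
  have lU: "lam' (f t) \<in> (\<Union>n. C n)" for t
    using fC C.lam_grade by blast
  have fl: "f (lam t) = lam' (f t)" for t
    using f1[of t emp] C.oplus_right_id[OF lU] ptree.oplus_right_id[of "lam t"] f0 by simp
  have fp: "f (t \<oplus> u) = oplus' (f t) (f u)" for t u
  proof (induction t rule: ptree_induct)
    case emp
    then show ?case using C.oplus_left_id[OF fU] ptree.oplus_left_id[of u] f0 by simp
  next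
    case (cons a b)
    have "(lam a \<oplus> b) \<oplus> u = lam a \<oplus> (b \<oplus> u)"
      by (rule ptree.oplus_assoc) auto
    then show ?case using cons C.oplus_assoc[OF lU fU fU] by (simp add: f1)
  qed
  show ?thesis
  proof (rule ex1I[of _ f])
    fix g
    assume g: "(\<forall>t. g t \<in> C (edges t)) \<and> g emp = e' \<and> (\<forall>t. g (lam t) = lam' (g t)) \<and>
              (\<forall>t u. g (t \<oplus> u) = oplus' (g t) (g u))"
    have "g t = f t" for t
      by (induction t rule: ptree_induct) (simp_all add: g f0 f1)
    then show "g = f" by blast
  qed (use f0 fl fp fC in blast)
qed

definition gamma :: "ptree \<Rightarrow> ptree" where
  "gamma t = t \<oplus> lam emp"

fun ominus :: "ptree \<Rightarrow> ptree \<Rightarrow> ptree"  (infixr "\<ominus>" 65) where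
  "Node [] \<ominus> v = v"
| "Node [u] \<ominus> v = lam (u \<ominus> v)"
| "Node (t # u # us) \<ominus> v = lam t \<oplus> (Node (u # us) \<ominus> v)"

fun h :: "ptree \<Rightarrow> ptree" where
  "h (Node []) = emp"
| "h (Node (u # vs)) = h (Node vs) \<ominus> gamma (h u)"

fun rev_tree :: "ptree \<Rightarrow> ptree" where
  "rev_tree (Node []) = emp"
| "rev_tree (Node (u # vs)) = rev_tree (Node vs) \<oplus> lam (rev_tree u)"

definition M :: "ptree \<Rightarrow> ptree" where
  "M = h \<circ> rev_tree"

text \<open>The defining equations, in terms of the Catalan operations.\<close>

lemma ominus_emp: "emp \<ominus> v = v"
  by (simp add: emp_def)

lemma ominus_lam: "lam u \<ominus> v = lam (u \<ominus> v)"
  by (simp add: lam_def)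

lemma ominus_oplus:
  assumes "t \<noteq> emp" "u \<noteq> emp"
  shows "(t \<oplus> u) \<ominus> v = t \<oplus> (u \<ominus> v)"
proof -
  obtain x xs where u: "u = Node (x # xs)"
    using assms(2) by (cases u rule: edges.cases) (auto simp: emp_def)
  have "Node (ts @ x # xs) \<ominus> v = Node ts \<oplus> (u \<ominus> v)" for ts
  proof (induction ts)
    case Nil
    then show ?case by (cases "u \<ominus> v") (simp add: u oplus_def)
  next
    case (Cons a ts)
    then show ?case by (cases ts) (simp_all add: u oplus_def lam_def)
  qed
  then show ?thesis by (cases t) (simp add: u oplus_def)
qed

lemma h_emp: "h emp = emp"
  and h_cons: "h (lam u \<oplus> v) = h v \<ominus> gamma (h u)"
  by (simp add: emp_def) (cases v, simp add: lam_def oplus_def)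

lemma rev_tree_emp: "rev_tree emp = emp"
  and rev_tree_cons: "rev_tree (lam u \<oplus> v) = rev_tree v \<oplus> lam (rev_tree u)"
  by (simp add: emp_def) (cases v, simp add: lam_def oplus_def)

end

theory Submission
  imports Defs
begin

text \<open>
  The operation \<open>\<ominus>\<close> is again associative with two-sided identity \<open>e\<close>. Hence \<open>rev\<close> and \<open>h\<close>
  are both monoid antihomomorphisms, from \<open>\<oplus>\<close> to \<open>\<oplus>\<close> and from \<open>\<oplus>\<close> to \<open>\<ominus>\<close> respectively, so
  that their composition preserves the order of the factors.
\<close>

lemma oplus_emp_left [simp]: "emp \<oplus> t = t"
  and oplus_emp_right [simp]: "t \<oplus> emp = t"
  by (cases t, simp add: oplus_def emp_def)+

lemma oplus_assoc: "(t \<oplus> u) \<oplus> v = t \<oplus> (u \<oplus> v)"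
  by (simp add: oplus_def)

lemma lam_neq_emp [simp]: "lam t \<noteq> emp"
  by (simp add: lam_def emp_def)

lemma ominus_neq_emp: "t \<noteq> emp \<Longrightarrow> t \<ominus> v \<noteq> emp"
  by (induction t v rule: ominus.induct) (auto simp: emp_def lam_def oplus_def)

lemma ominus_emp_right [simp]: "t \<ominus> emp = t"
  by (induction t "emp" rule: ominus.induct) (auto simp: emp_def lam_def oplus_def)

text \<open>\<open>t \<ominus> v\<close> grafts \<open>v\<close> onto the rightmost leaf of
  \<open>t\<close>, and its own rightmost leaf is that of the grafted \<open>v\<close>.\<close>

lemma ominus_assoc: "(t \<ominus> v) \<ominus> w = t \<ominus> (v \<ominus> w)"
proof (induction t v rule: ominus.induct)
  case (3 t u us v)
  \<comment> \<open>Nonemptiness lets \<open>ominus_oplus\<close> move \<open>\<ominus> w\<close>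
    past the leading \<open>lam t\<close>.\<close>
  have "Node (u # us) \<ominus> v \<noteq> emp"
    by (rule ominus_neq_emp) (simp add: emp_def)
  then show ?case
    using 3 by (simp add: ominus_oplus)
qed (simp_all add: ominus_lam)

lemma rev_tree_oplus: "rev_tree (u \<oplus> v) = rev_tree v \<oplus> rev_tree u"
  by (induction u rule: ptree_induct) (simp_all add: rev_tree_emp rev_tree_cons oplus_assoc)

lemma rev_tree_lam: "rev_tree (lam t) = lam (rev_tree t)"
  using rev_tree_cons[of t emp] by (simp add: rev_tree_emp)

text \<open>For \<open>u = lam a \<oplus> b\<close>, both sides are bracketings of
  \<open>h v \<ominus> h b \<ominus> gamma (h a)\<close>; for \<open>u = emp\<close>,
  \<open>emp\<close> is a right identity of \<open>\<ominus>\<close>.\<close>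

lemma h_oplus: "h (u \<oplus> v) = h v \<ominus> h u"
  by (induction u rule: ptree_induct) (simp_all add: h_emp h_cons oplus_assoc ominus_assoc)

lemma h_lam: "h (lam t) = gamma (h t)"
  using h_cons[of t emp] by (simp add: h_emp ominus_emp)

theorem theorem5p5:
  fixes t u v :: ptree
  shows "M emp = emp \<and> M (lam t) = gamma (M t) \<and> M (u \<oplus> v) = M u \<ominus> M v"
  by (simp add: M_def rev_tree_emp h_emp rev_tree_lam h_lam rev_tree_oplus h_oplus)

end
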